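(* Let $0\le M\le N$. The problem RMSC with storage capacity $M$ has an optimal solution $$\boldsymbol{y}^*_{\mathrm{RMSC}}(M)=\begin{cases}\boldsymbol{y}^*_{\mathrm{JRSM}}(M), & M\in\mathcal{M},\\[4pt] \dfrac{M_{\mathrm u}-M}{M_{\mathrm u}-M_{\mathrm l}}\,\boldsymbol{y}^*_{\mathrm{JRSM}}(M_{\mathrm l})+\dfrac{M-M_{\mathrm l}}{M_{\mathrm u}-M_{\mathrm l}}\,\boldsymbol{y}^*_{\mathrm{JRSM}}(M_{\mathrm u}), & M\notin\mathcal{M},\end{cases}$$ where, for $m\in\mathcal{M}$, $\boldsymbol{y}^*_{\mathrm{JRSM}}(m)$ is the optimal solution of JRSM in $\mathcal{Y}^*$ that uses storage $m$, and $M_{\mathrm l}$ and $M_{\mathrm u}$ are respectively the largest element of $\mathcal{M}$ smaller than $M$ and the smallest element of $\mathcal{M}$ larger than $M$.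
   Context: Notation: $[n]=\{1,\ldots,n\}$. $K$ (number of caches) and $N$ (number of files) are positive integers. $p_1\le\cdots\le p_N$ are the request probabilities of the files (nonnegative, summing to 1). $\mathcal{G}_s$ is the set of subsets of $[N]$ of cardinality at most $s$. For $s\ge1$ and $g\in\mathcal{G}_s$, $\pi_s^g$ is the probability that, when $s$ files are drawn independently from $[N]$ according to $(p_n)$, the set of distinct files drawn equals $g$ (the empty set has probability 0 and contributes nothing). Placement parameters are $\boldsymbol{y}=(y^n_s)_{n\in[N],\,0\le s\le K}$ with real entries. Expected delivery rate and storage used: $$r(\boldsymbol{y})=\sum_{s=0}^{K-1}\frac{K-s}{s+1}\sum_{g\in\mathcal{G}_{s+1}}\pi^g_{s+1}\max_{n\in g}y^n_s,\qquad m(\boldsymbol{y})=\sum_{n=1}^N\sum_{s=1}^K\frac{s}{K}y^n_s.$$ Call $\boldsymbol{y}$ a placement if $\sum_{s=0}^K y^n_s=1$ for all $n\in[N]$ and all $y^n_s\ge0$. RMSC (Rate Minimization with Storage Constraint) with capacity $M$: minimize $r(\boldsymbol{y})$ over placements $\boldsymbol{y}$ with $m(\boldsymbol{y})\le M$. JRSM (Joint Rate and Storage Minimization) with parameter $\gamma\ge0$: minimize $r(\boldsymbol{y})+\gamma\,m(\boldsymbol{y})$ over placements $\boldsymbol{y}$. A two-group vector is a placement of the form $y^n_0=1$ for $n\le n^*$, $y^n_{s^*}=1$ for $n>n^*$, and all other entries $0$, for some $s^*\in[K]$, $n^*\in\{0,\ldots,N\}$ (there are at most $KN+1$ of these). $\mathcal{Y}^*$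 is a finite set of two-group vectors, each optimal for JRSM for some $\gamma\ge0$, that contains at least one optimal solution of JRSM for every $\gamma\ge0$. $\mathcal{M}=\{m(\boldsymbol{y}):\boldsymbol{y}\in\mathcal{Y}^*\}$; its elements, sorted increasingly, are $0=M_0<M_1<\cdots<M_l=N$. *)

theory Defs
  imports "HOL-Probability.Probability"
begin

text \<open>
  A parameter vector \<open>(y\<^sup>n\<^sub>s)\<close> with \<open>n \<in> [N]\<close> and \<open>0 \<le> s \<le> K\<close> is a function \<open>y n s\<close>. The popularity
  distribution is a \<open>nat pmf\<close> whose support lies in \<open>{1..N}\<close>, so files of probability zero are
  allowed.
\<close>

type_synonym params = "nat \<Rightarrow> nat \<Rightarrow> real"

definition file_subsets :: "nat \<Rightarrow> nat \<Rightarrow> nat set set" where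
  "file_subsets N s = {g. g \<subseteq> {1..N} \<and> card g \<le> s}"

definition request_prob :: "nat pmf \<Rightarrow> nat \<Rightarrow> nat set \<Rightarrow> real" where
  "request_prob p s g = measure_pmf.prob (replicate_pmf s p) {xs. set xs = g}"

text \<open>
  For \<open>g = {}\<close> the maximum below is an unspecified real, but its coefficient
  \<open>request_prob p (s + 1) {}\<close> is zero.
\<close>

definition rate :: "nat \<Rightarrow> nat \<Rightarrow> nat pmf \<Rightarrow> params \<Rightarrow> real" where
  "rate K N p y =
     (\<Sum>s = 0..<K. (real K - real s) / (real s + 1) *
        (\<Sum>g \<in> file_subsets N (s + 1).
           request_prob p (s + 1) g * Max ((\<lambda>n. y n s) ` g)))"

definition storage :: "nat \<Rightarrow> nat \<Rightarrow> params \<Rightarrow> real" where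
  "storage K N y = (\<Sum>n = 1..N. \<Sum>s = 1..K. real s / real K * y n s)"

text \<open>
  Entries outside the index range are fixed to \<open>0\<close>, so that placements correspond one to one
  to vectors indexed by \<open>[N] \<times> {0,\<dots>,K}\<close>.
\<close>

definition placement :: "nat \<Rightarrow> nat \<Rightarrow> params \<Rightarrow> bool" where
  "placement K N y \<longleftrightarrow>
     (\<forall>n \<in> {1..N}. (\<Sum>s = 0..K. y n s) = 1) \<and>
     (\<forall>n \<in> {1..N}. \<forall>s \<in> {0..K}. 0 \<le> y n s) \<and>
     (\<forall>n s. n \<notin> {1..N} \<or> s \<notin> {0..K} \<longrightarrow> y n s = 0)"

definition RMSC_optimal :: "nat \<Rightarrow> nat \<Rightarrow> nat pmf \<Rightarrow> real \<Rightarrow> params \<Rightarrow> bool" where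
  "RMSC_optimal K N p M =
     is_arg_min (rate K N p) (\<lambda>y. placement K N y \<and> storage K N y \<le> M)"

definition JRSM_optimal :: "nat \<Rightarrow> nat \<Rightarrow> nat pmf \<Rightarrow> real \<Rightarrow> params \<Rightarrow> bool" where
  "JRSM_optimal K N p \<gamma> =
     is_arg_min (\<lambda>y. rate K N p y + \<gamma> * storage K N y) (placement K N)"

definition two_group :: "nat \<Rightarrow> nat \<Rightarrow> params \<Rightarrow> bool" where
  "two_group K N y \<longleftrightarrow>
     placement K N y \<and>
     (\<exists>s' \<in> {1..K}. \<exists>n' \<in> {0..N}. \<forall>n \<in> {1..N}. \<forall>s \<in> {0..K}.
        y n s = (if s = (if n \<le> n' then 0 else s') then 1 else 0))"

definition RMSC_solution :: "real set \<Rightarrow> (real \<Rightarrow> params) \<Rightarrow> real \<Rightarrow> params" where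
  "RMSC_solution MM yJ M =
     (if M \<in> MM then yJ M
      else
        (let Ml = Max {m \<in> MM. m < M};
             Mu = Min {m \<in> MM. M < m}
         in (\<lambda>n s. (Mu - M) / (Mu - Ml) * yJ Ml n s + (M - Ml) / (Mu - Ml) * yJ Mu n s)))"

end

theory Submission
  imports Defs
begin

text \<open>
  The Lagrangian argument: a minimizer of \<open>r + \<gamma> m\<close> minimizes \<open>r\<close> among all points that use no
  more storage. For \<open>M\<close> strictly between two consecutive storage values, the negated slope \<open>\<gamma>\<close> of the
  chord through the two corresponding points \<open>(m, r)\<close> makes both of them optimal for JRSM, and by
  convexity of \<open>r\<close> their interpolation is optimal for the same \<open>\<gamma>\<close> with storage exactly \<open>M\<close>.
\<close>

lemma Max_image_convex_comb_le:
  fixes f h :: "'a \<Rightarrow> real"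
  assumes "finite g" "g \<noteq> {}" "0 \<le> a" "0 \<le> b"
  shows "Max ((\<lambda>n. a * f n + b * h n) ` g) \<le> a * Max (f ` g) + b * Max (h ` g)"
proof -
  have "a * f n + b * h n \<le> a * Max (f ` g) + b * Max (h ` g)" if "n \<in> g" for n
    using that assms by (intro add_mono mult_left_mono) auto
  then show ?thesis
    using assms by simp
qed

lemma request_prob_nonneg: "0 \<le> request_prob p s g"
  by (simp add: request_prob_def)

text \<open>At least one draw yields at least one file. This removes the term \<open>g = {}\<close>,
  whose \<open>Max\<close> is unspecified; with zero draws the probability would be 1.\<close>

lemma request_prob_empty: "request_prob p (Suc s) {} = 0"
  by (auto simp: request_prob_def measure_pmf_zero_iff set_replicate_pmf)

text \<open>Each maximum is sublinear in the parameters, and the rate sums such maxima with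
  nonnegative coefficients.\<close>

lemma rate_convex_comb_le:
  assumes "0 \<le> a" "0 \<le> b"
  shows "rate K N p (\<lambda>n s. a * y n s + b * z n s) \<le> a * rate K N p y + b * rate K N p z"
proof -
  let ?c = "\<lambda>s. (real K - real s) / (real s + 1)"
  let ?R = "\<lambda>y s g. request_prob p (s + 1) g * Max ((\<lambda>n. y n s) ` g)"
  have summand: "?R (\<lambda>n s. a * y n s + b * z n s) s g \<le> a * ?R y s g + b * ?R z s g"
    if "g \<in> file_subsets N (s + 1)" for s g
  proof (cases "g = {}")
    case True
    then show ?thesis
      by (simp add: request_prob_empty)
  next
    case False
    have "finite g"
      using that by (auto simp: file_subsets_def intro: finite_subset)
    from mult_left_mono[OF Max_image_convex_comb_le[OF this False assms] request_prob_nonneg]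
    show ?thesis
      by (simp add: algebra_simps)
  qed
  have "rate K N p (\<lambda>n s. a * y n s + b * z n s)
      \<le> (\<Sum>s = 0..<K. ?c s * (\<Sum>g \<in> file_subsets N (s + 1). a * ?R y s g + b * ?R z s g))"
    \<comment> \<open>The factor \<open>?c s\<close> is nonnegative because \<open>s < K\<close>
      throughout the sum.\<close>
    unfolding rate_def by (intro sum_mono mult_left_mono summand) auto
  also have "\<dots> = a * rate K N p y + b * rate K N p z"
    by (simp add: rate_def sum.distrib sum_distrib_left distrib_left mult.left_commute)
  finally show ?thesis .
qed

lemma storage_linear:
  "storage K N (\<lambda>n s. a * y n s + b * z n s) = a * storage K N y + b * storage K N z"
  by (simp add: storage_def sum.distrib sum_distrib_left distrib_left mult.left_commute)

lemma storage_nonneg: "placement K N y \<Longrightarrow> 0 \<le> storage K N y"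
  unfolding storage_def placement_def by (intro sum_nonneg mult_nonneg_nonneg) auto

lemma placement_convex_comb:
  assumes "placement K N y" "placement K N z" "0 \<le> a" "0 \<le> b" "a + b = 1"
  shows "placement K N (\<lambda>n s. a * y n s + b * z n s)"
  using assms by (auto simp: placement_def sum.distrib simp flip: sum_distrib_left)

lemma ex_placement_storage_0: "\<exists>z. placement K N z \<and> storage K N z = 0"
proof -
  define z :: params where "z n s = (if n \<in> {1..N} \<and> s = 0 then 1 else 0)" for n s
  have "placement K N z"
    by (auto simp: placement_def z_def)
  moreover have "storage K N z = 0"
    by (simp add: storage_def z_def)
  ultimately show ?thesis
    by blast
qed

lemma JRSM_optimal_iff:
  "JRSM_optimal K N p \<gamma> y \<longleftrightarrow> placement K N y \<and>
     (\<forall>z. placement K N z \<longrightarrow>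
       rate K N p y + \<gamma> * storage K N y \<le> rate K N p z + \<gamma> * storage K N z)"
  by (auto simp: JRSM_optimal_def is_arg_min_linorder)

text \<open>A competitor with no more storage pays no larger penalty, as \<gamma> is nonnegative, so
  it cannot have a smaller rate.\<close>

lemma JRSM_optimal_imp_RMSC_optimal:
  assumes "JRSM_optimal K N p \<gamma> y" "0 \<le> \<gamma>"
  shows "RMSC_optimal K N p (storage K N y) y"
  unfolding RMSC_optimal_def is_arg_min_linorder
proof (intro conjI allI impI)
  fix z
  assume z: "placement K N z \<and> storage K N z \<le> storage K N y"
  have "\<gamma> * storage K N z \<le> \<gamma> * storage K N y"
    using z assms(2) by (intro mult_left_mono) auto
  with z assms(1) show "rate K N p y \<le> rate K N p z"
    unfolding JRSM_optimal_iff by fastforce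
qed (use assms in \<open>auto simp: JRSM_optimal_iff\<close>)

text \<open>The objective is convex, since the rate is convex and the storage linear, so its
  minimizers over the convex set of placements form a convex set.\<close>

lemma JRSM_optimal_convex_comb:
  assumes "JRSM_optimal K N p \<gamma> y" "JRSM_optimal K N p \<gamma> z" "0 \<le> a" "0 \<le> b" "a + b = 1"
  shows "JRSM_optimal K N p \<gamma> (\<lambda>n s. a * y n s + b * z n s)" (is "JRSM_optimal _ _ _ _ ?w")
  unfolding JRSM_optimal_iff
proof (intro conjI allI impI)
  show "placement K N ?w"
    using assms by (simp add: JRSM_optimal_iff placement_convex_comb)
next
  fix x
  assume x: "placement K N x"
  let ?L = "\<lambda>y. rate K N p y + \<gamma> * storage K N y"
  have "?L ?w \<le> a * ?L y + b * ?L z"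
    using rate_convex_comb_le[OF assms(3,4), of K N p y z]
    by (simp add: storage_linear algebra_simps)
  also have "\<dots> \<le> a * ?L x + b * ?L x"
  proof -
    have "?L y \<le> ?L x" "?L z \<le> ?L x"
      using assms(1,2) x by (simp_all add: JRSM_optimal_iff)
    then show ?thesis
      using assms(3,4) by (intro add_mono[OF mult_left_mono mult_left_mono])
  qed
  also have "\<dots> = ?L x"
    using assms(5) by (metis distrib_right mult_1)
  finally show "?L ?w \<le> ?L x" .
qed

text \<open>If all members of the finite set \<open>Y\<close> used positive storage, a large enough
  multiplier would make each of them worse than caching nothing. This supplies a storage value below
  any positive capacity.\<close>

lemma storage_0_in_JRSM_cover:
  assumes fin: "finite Y" and pl: "\<forall>y \<in> Y. placement K N y"
    and cover: "\<forall>\<gamma> \<ge> 0. \<exists>y \<in> Y. JRSM_optimal K N p \<gamma> y"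
  shows "0 \<in> storage K N ` Y"
proof (rule ccontr)
  assume no0: "0 \<notin> storage K N ` Y"
  have pos: "0 < storage K N y" if "y \<in> Y" for y
    using no0 that pl storage_nonneg[of K N y] by (metis image_eqI less_eq_real_def)
  obtain z where z: "placement K N z" "storage K N z = 0"
    using ex_placement_storage_0 by blast
  \<comment> \<open>\<open>q y\<close> is the multiplier at which \<open>y\<close> and the empty
    cache \<open>z\<close> have equal objective values.\<close>
  define q where "q y = (rate K N p z - rate K N p y) / storage K N y" for y
  \<comment> \<open>Inserting 0 keeps \<gamma> nonnegative; adding 1 puts it strictly above every
    break-even value.\<close>
  define \<gamma> where "\<gamma> = Max (insert 0 (q ` Y)) + 1"
  have q: "q y < \<gamma>" if "y \<in> Y" for y
  proof -
    have "q y \<le> Max (insert 0 (q ` Y))"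
      using fin that by (intro Max_ge) auto
    then show ?thesis
      unfolding \<gamma>_def by linarith
  qed
  have "0 \<le> \<gamma>"
    using Max_ge[of "insert 0 (q ` Y)" 0] fin by (simp add: \<gamma>_def del: Max_insert)
  then obtain y where y: "y \<in> Y" "JRSM_optimal K N p \<gamma> y"
    using cover by blast
  have "rate K N p z - rate K N p y < \<gamma> * storage K N y"
    using q[OF y(1)] pos[OF y(1)] by (simp add: q_def pos_divide_less_eq)
  moreover have "rate K N p y + \<gamma> * storage K N y \<le> rate K N p z"
    using y(2) z by (auto simp: JRSM_optimal_iff)
  ultimately show False
    by simp
qed

text \<open>At the multiplier where \<open>y\<close> and \<open>z\<close> tie, the cover provides
  some optimal \<open>x\<close>. Its storage is not strictly between theirs, so the known optimality
  of \<open>y\<close> or of \<open>z\<close> shows that \<open>x\<close> does no better than the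
  two.\<close>

lemma adjacent_JRSM_common_multiplier:
  assumes opt: "JRSM_optimal K N p \<alpha> y" "JRSM_optimal K N p \<beta> z" "0 \<le> \<beta>"
    and less: "storage K N y < storage K N z"
    and cover: "\<forall>\<gamma> \<ge> 0. \<exists>x \<in> Y. JRSM_optimal K N p \<gamma> x"
    and gap: "\<forall>x \<in> Y. storage K N x \<le> storage K N y \<or> storage K N z \<le> storage K N x"
  shows "\<exists>\<gamma> \<ge> 0. JRSM_optimal K N p \<gamma> y \<and> JRSM_optimal K N p \<gamma> z"
proof -
  let ?r = "rate K N p" and ?m = "storage K N"
  define \<gamma> where "\<gamma> = (?r y - ?r z) / (?m z - ?m y)"
  have pl: "placement K N y" "placement K N z"
    using opt by (auto simp: JRSM_optimal_iff)
  have y: "?r y + \<alpha> * ?m y \<le> ?r x + \<alpha> * ?m x"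
    and z: "?r z + \<beta> * ?m z \<le> ?r x + \<beta> * ?m x" if "placement K N x" for x
    using opt that by (auto simp: JRSM_optimal_iff)
  \<comment> \<open>Testing \<open>y\<close> against \<open>z\<close> at \<alpha>, and then
    \<open>z\<close> against \<open>y\<close> at \<beta>, encloses the tie multiplier between
    \<beta> and \<alpha>.\<close>
  have "\<gamma> \<le> \<alpha>"
    using y[OF pl(2)] less by (simp add: \<gamma>_def pos_divide_le_eq algebra_simps)
  have "\<beta> \<le> \<gamma>"
    using z[OF pl(1)] less by (simp add: \<gamma>_def pos_le_divide_eq algebra_simps)
  have "\<gamma> * (?m z - ?m y) = ?r y - ?r z"
    using less by (simp add: \<gamma>_def)
  then have eq: "?r y + \<gamma> * ?m y = ?r z + \<gamma> * ?m z"
    by (simp add: algebra_simps)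
  have "0 \<le> \<gamma>"
    using \<open>0 \<le> \<beta>\<close> \<open>\<beta> \<le> \<gamma>\<close> by simp
  then obtain x where x: "x \<in> Y" "JRSM_optimal K N p \<gamma> x"
    using cover by blast
  then have plx: "placement K N x"
    by (simp add: JRSM_optimal_iff)
  \<comment> \<open>Lowering the multiplier from \<alpha> to \<gamma> favours \<open>y\<close> over
    points with less storage; raising it from \<beta> to \<gamma> favours \<open>z\<close> over
    points with more, and \<open>eq\<close> carries the bound over to \<open>y\<close>.\<close>
  have "?r y + \<gamma> * ?m y \<le> ?r x + \<gamma> * ?m x"
    using gap[rule_format, OF x(1)]
  proof
    assume "?m x \<le> ?m y"
    then have "\<gamma> * (?m y - ?m x) \<le> \<alpha> * (?m y - ?m x)"
      using \<open>\<gamma> \<le> \<alpha>\<close> by (intro mult_right_mono) auto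
    then show ?thesis
      using y[OF plx] by (simp add: algebra_simps)
  next
    assume "?m z \<le> ?m x"
    then have "\<beta> * (?m x - ?m z) \<le> \<gamma> * (?m x - ?m z)"
      using \<open>\<beta> \<le> \<gamma>\<close> by (intro mult_right_mono) auto
    then show ?thesis
      using z[OF plx] eq by (simp add: algebra_simps)
  qed
  then have "JRSM_optimal K N p \<gamma> y" "JRSM_optimal K N p \<gamma> z"
    using x(2) pl eq unfolding JRSM_optimal_iff by fastforce+
  with \<open>0 \<le> \<gamma>\<close> show ?thesis
    by blast
qed

theorem theorem2:
  fixes K N :: nat
    and p :: "nat pmf"
    and Ystar :: "params set"
    and MM :: "real set"
    and yJ :: "real \<Rightarrow> params"
    and M :: real
  assumes "K \<ge> 1" and "N \<ge> 1"
    and "set_pmf p \<subseteq> {1..N}"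
    and "mono_on {1..N} (pmf p)"
    and "finite Ystar"
    and "\<forall>y \<in> Ystar. two_group K N y \<and> (\<exists>\<gamma> \<ge> 0. JRSM_optimal K N p \<gamma> y)"
    and "\<forall>\<gamma> \<ge> 0. \<exists>y \<in> Ystar. JRSM_optimal K N p \<gamma> y"
    and "MM = storage K N ` Ystar"
    and "Max MM = real N"
    and "\<forall>m \<in> MM. yJ m \<in> Ystar \<and> storage K N (yJ m) = m"
    and "0 \<le> M" and "M \<le> real N"
  shows "RMSC_optimal K N p M (RMSC_solution MM yJ M)"
proof (cases "M \<in> MM")
  case True
  then obtain \<gamma> where "\<gamma> \<ge> 0" "JRSM_optimal K N p \<gamma> (yJ M)" "storage K N (yJ M) = M"
    using assms(6,10) by blast
  then have "RMSC_optimal K N p M (yJ M)"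
    using JRSM_optimal_imp_RMSC_optimal by metis
  then show ?thesis
    using True by (simp add: RMSC_solution_def)
next
  case False
  have fin: "finite MM"
    using assms(5,8) by simp
  \<comment> \<open>With 0 and \<open>real N\<close> in \<open>MM\<close>, a capacity outside
    \<open>MM\<close> has elements of \<open>MM\<close> on both sides, so \<open>Ml\<close> and
    \<open>Mu\<close> are well defined.\<close>
  have zero: "0 \<in> MM"
    unfolding assms(8) using assms(5-7)
    by (intro storage_0_in_JRSM_cover) (auto simp: two_group_def)
  then have "real N \<in> MM"
    using Max_in[of MM] fin assms(9) by auto
  define Ml Mu where "Ml = Max {m \<in> MM. m < M}" and "Mu = Min {m \<in> MM. M < m}"
  have "{m \<in> MM. m < M} \<noteq> {}"
    using zero False assms(11) by (auto intro!: exI[of _ 0] simp: less_le)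
  then have Ml: "Ml \<in> MM" "Ml < M"
    using Max_in[of "{m \<in> MM. m < M}"] fin by (auto simp: Ml_def)
  have Ml_max: "m \<le> Ml" if "m \<in> MM" "m < M" for m
    using fin that by (auto simp: Ml_def)
  have "{m \<in> MM. M < m} \<noteq> {}"
    using \<open>real N \<in> MM\<close> False assms(12) by (auto intro!: exI[of _ "real N"] simp: less_le)
  then have Mu: "Mu \<in> MM" "M < Mu"
    using Min_in[of "{m \<in> MM. M < m}"] fin by (auto simp: Mu_def)
  have Mu_min: "Mu \<le> m" if "m \<in> MM" "M < m" for m
    using fin that by (auto simp: Mu_def)
  have st: "storage K N (yJ Ml) = Ml" "storage K N (yJ Mu) = Mu"
    using assms(10) Ml Mu by auto
  obtain \<alpha> where "JRSM_optimal K N p \<alpha> (yJ Ml)"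
    using assms(6,10) Ml by blast
  moreover obtain \<beta> where "\<beta> \<ge> 0" "JRSM_optimal K N p \<beta> (yJ Mu)"
    using assms(6,10) Mu by blast
  \<comment> \<open>No member of \<open>Ystar\<close> uses storage exactly \<open>M\<close>, so each
    lies on one side of \<open>M\<close>, hence outside the gap.\<close>
  moreover have "storage K N x \<le> Ml \<or> Mu \<le> storage K N x" if "x \<in> Ystar" for x
    using Ml_max Mu_min False that assms(8) by (metis image_eqI linorder_neqE)
  ultimately obtain \<gamma> where \<gamma>: "\<gamma> \<ge> 0" "JRSM_optimal K N p \<gamma> (yJ Ml)" "JRSM_optimal K N p \<gamma> (yJ Mu)"
    using adjacent_JRSM_common_multiplier[of K N p \<alpha> "yJ Ml" \<beta> "yJ Mu" Ystar] st assms(7) Ml Mu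
    by auto
  define a b where "a = (Mu - M) / (Mu - Ml)" and "b = (M - Ml) / (Mu - Ml)"
  have ab: "0 \<le> a" "0 \<le> b" "a + b = 1"
    using Ml Mu by (auto simp: a_def b_def simp flip: add_divide_distrib)
  \<comment> \<open>The weights interpolate \<open>M\<close> between \<open>Ml\<close> and
    \<open>Mu\<close>, so the combination uses storage exactly \<open>M\<close>, and its optimality
    for JRSM gives optimality for RMSC at that capacity.\<close>
  have "a * Ml + b * Mu = ((Mu - M) * Ml + (M - Ml) * Mu) / (Mu - Ml)"
    by (simp add: a_def b_def add_divide_distrib)
  also have "\<dots> = M"
    using Ml Mu by (simp add: divide_eq_eq algebra_simps)
  finally have "storage K N (\<lambda>n s. a * yJ Ml n s + b * yJ Mu n s) = M"
    by (simp add: storage_linear st)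
  then have "RMSC_optimal K N p M (\<lambda>n s. a * yJ Ml n s + b * yJ Mu n s)"
    using JRSM_optimal_imp_RMSC_optimal[OF JRSM_optimal_convex_comb[OF \<gamma>(2,3) ab] \<gamma>(1)] by simp
  then show ?thesis
    using False by (simp add: RMSC_solution_def Let_def a_def b_def Ml_def Mu_def)
qed

end
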